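(* Let $F$ be a distribution function on $\mathbb{R}$. Then $F$ belongs to the free max-domain of attraction of the exponential distribution function $(1-e^{-x})_+$ if and only if $F$ belongs to the classical max-domain of attraction of the Gumbel distribution function $\Lambda(x)=\exp(-e^{-x})$. Moreover the normalizing constants are equal: for real sequences $(a_n)_{n\ge1}$, $(b_n)_{n\ge1}$ with $a_n>0$, one has $F^{\veebar n}(a_nx+b_n)\to (1-e^{-x})_+$ for all $x\in\mathbb{R}$ if and only if $F(a_nx+b_n)^n\to \exp(-e^{-x})$ for all $x\in\mathbb{R}$.
   Context: A distribution function on $\mathbb{R}$ is $F(t)=\mu((-\infty,t])$ for a Borel probability measure $\mu$ on $\mathbb{R}$. Write $u_+=\max(u,0)$. For distribution functions $F,G$ put $F\veebar G=(F+G-1)_+$ (upper extremal free convolution); its $n$-fold iterate is $F^{\veebar n}=(nF-(n-1))_+$, equivalently $1-F^{\veebar n}=\min(n(1-F),1)$. $F$ is in the free max-domain of attraction of a distribution function $G$ if there exist $a_n,b_n\in\mathbb{R}$, $a_n>0$, such that $F^{\veebar n}(a_nx+b_n)\to G(x)$ as $n\to\infty$ at every continuity point $x$ of $G$. $F$ is in the classical max-domain of attraction of $G$ if there exist $a_n,b_n\in\mathbb{R}$, $a_n>0$, such that $F(a_nx+b_n)^n\to G(x)$ at every continuity point $x$ of $G$. *)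

theory Defs
  imports "HOL-Probability.Distribution_Functions"
begin

definition distribution_function :: "(real \<Rightarrow> real) \<Rightarrow> bool" where
  "distribution_function F \<longleftrightarrow> (\<exists>M. real_distribution M \<and> F = cdf M)"

definition free_max :: "(real \<Rightarrow> real) \<Rightarrow> (real \<Rightarrow> real) \<Rightarrow> real \<Rightarrow> real" where
  "free_max F G = (\<lambda>t. max (F t + G t - 1) 0)"

text \<open>The \<open>n\<close>-fold iterate of \<^const>\<open>free_max\<close>. The value at \<open>0\<close> is the neutral element, the
  constant function 1 (not itself a distribution function); only \<open>n \<ge> 1\<close> is meaningful.\<close>

primrec free_max_power :: "(real \<Rightarrow> real) \<Rightarrow> nat \<Rightarrow> real \<Rightarrow> real" where
  "free_max_power F 0 = (\<lambda>t. 1)"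
| "free_max_power F (Suc n) = free_max (free_max_power F n) F"

text \<open>The constraint on the scaling constants is imposed only for \<open>n \<ge> 1\<close>: the sequences start
  at 1, and their values at 0 are irrelevant.\<close>

definition free_max_domain_of_attraction :: "(real \<Rightarrow> real) \<Rightarrow> (real \<Rightarrow> real) set" where
  "free_max_domain_of_attraction G =
    {F. distribution_function F \<and>
        (\<exists>a b. (\<forall>n\<ge>1. 0 < a n) \<and>
          (\<forall>x. isCont G x \<longrightarrow> (\<lambda>n. free_max_power F n (a n * x + b n)) \<longlonglongrightarrow> G x))}"

definition classical_max_domain_of_attraction :: "(real \<Rightarrow> real) \<Rightarrow> (real \<Rightarrow> real) set" where
  "classical_max_domain_of_attraction G =
    {F. distribution_function F \<and>
        (\<exists>a b. (\<forall>n\<ge>1. 0 < a n) \<and>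
          (\<forall>x. isCont G x \<longrightarrow> (\<lambda>n. F (a n * x + b n) ^ n) \<longlonglongrightarrow> G x))}"

definition exponential_df :: "real \<Rightarrow> real" where
  "exponential_df x = max (1 - exp (- x)) 0"

definition gumbel_df :: "real \<Rightarrow> real" where
  "gumbel_df x = exp (- exp (- x))"

lemma distribution_function_bounds:
  assumes "distribution_function F"
  shows "0 \<le> F t" "F t \<le> 1"
proof -
  obtain M where M: "real_distribution M" "F = cdf M"
    using assms by (auto simp: distribution_function_def)
  interpret real_distribution M by fact
  show "0 \<le> F t" "F t \<le> 1"
    by (auto simp: M cdf_nonneg cdf_bounded_prob)
qed

lemma free_max_power_eq:
  assumes "distribution_function F"
  shows "free_max_power F n t = max (real n * F t - (real n - 1)) 0"
proof (induction n)
  case (Suc n)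
  then show ?case
    using distribution_function_bounds[OF assms, of t]
    by (auto simp: free_max_def max_def algebra_simps)
qed simp

lemma free_max_power_1:
  assumes "distribution_function F"
  shows "free_max_power F 1 = F"
  using distribution_function_bounds[OF assms] by (auto simp: free_max_def fun_eq_iff max_def intro: antisym)

lemma one_minus_free_max_power:
  assumes "distribution_function F"
  shows "1 - free_max_power F n t = min (real n * (1 - F t)) 1"
  unfolding free_max_power_eq[OF assms] by (auto simp: max_def min_def algebra_simps)

lemma distribution_functionI:
  assumes mono: "\<And>x y. x \<le> y \<Longrightarrow> F x \<le> F y"
    and cont: "continuous_on UNIV F"
    and bot: "(F \<longlongrightarrow> 0) at_bot" and top: "(F \<longlongrightarrow> 1) at_top"
  shows "distribution_function F"
proof -
  have rc: "continuous (at_right x) F" for x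
    using cont by (auto simp: continuous_on_eq_continuous_at intro: continuous_at_imp_continuous_at_within)
  show ?thesis
    unfolding distribution_function_def
    using real_distribution_interval_measure[of F, OF mono rc bot top]
      cdf_interval_measure[of F, OF mono rc bot] by metis
qed

lemma distribution_function_exponential_df: "distribution_function exponential_df"
proof (rule distribution_functionI)
  show "continuous_on UNIV exponential_df"
    unfolding exponential_df_def by (intro continuous_intros)
  have "eventually (\<lambda>x::real. exponential_df x = 0) at_bot"
    using eventually_le_at_bot[of 0] by eventually_elim (simp add: exponential_df_def)
  then show "(exponential_df \<longlongrightarrow> 0) at_bot"
    by (rule tendsto_eventually)
  have "((\<lambda>x::real. exp (- x)) \<longlongrightarrow> 0) at_top"
    by (rule filterlim_compose[OF exp_at_bot filterlim_uminus_at_bot_at_top])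
  then have "((\<lambda>x::real. max (1 - exp (- x)) 0) \<longlongrightarrow> max (1 - 0) 0) at_top"
    by (intro tendsto_intros)
  then show "(exponential_df \<longlongrightarrow> 1) at_top"
    by (simp add: exponential_df_def[abs_def])
qed (auto simp: exponential_df_def max_def)

lemma distribution_function_gumbel_df: "distribution_function gumbel_df"
proof (rule distribution_functionI)
  show "continuous_on UNIV gumbel_df"
    unfolding gumbel_df_def by (intro continuous_intros)
  have "filterlim (\<lambda>x::real. exp (- x)) at_top at_bot"
    by (rule filterlim_compose[OF exp_at_top filterlim_uminus_at_top_at_bot])
  then show "(gumbel_df \<longlongrightarrow> 0) at_bot"
    unfolding gumbel_df_def[abs_def]
    by (intro filterlim_compose[OF exp_at_bot] filterlim_compose[OF filterlim_uminus_at_bot_at_top])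
  have "((\<lambda>x::real. exp (- x)) \<longlongrightarrow> 0) at_top"
    by (rule filterlim_compose[OF exp_at_bot filterlim_uminus_at_bot_at_top])
  then have "((\<lambda>x::real. exp (- exp (- x))) \<longlongrightarrow> exp (- 0)) at_top"
    by (intro tendsto_intros)
  then show "(gumbel_df \<longlongrightarrow> 1) at_top"
    by (simp add: gumbel_df_def[abs_def])
qed (auto simp: gumbel_df_def)

end

theory Submission
  imports Defs
begin

text \<open>
  Write \<open>T n x = n (1 - F (a\<^sub>n x + b\<^sub>n))\<close>. Taking logarithms, \<open>F (a\<^sub>n x + b\<^sub>n) ^ n\<close> tends to
  \<open>exp (- exp (- x))\<close> if and only if \<open>T n x\<close> tends to \<open>exp (- x)\<close>, while the free iterate is
  \<open>max (1 - T n x) 0\<close>. The classical limit therefore gives the free one at once. In the other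
  direction the truncation hides the limit of \<open>T n x\<close> for \<open>x \<le> 0\<close>: the free limit only says
  \<open>T n x \<longlonglongrightarrow> exp (- x)\<close> for \<open>x > 0\<close>.

  The missing half line is recovered by changing the index. Fix an integer \<open>K\<close> and put
  \<open>m = n div K\<close>. Since \<open>n / m\<close> tends to \<open>K\<close>, the scaling with index \<open>m\<close> sees the tail \<open>1 - F\<close> at
  height \<open>K exp (- x) / n\<close>, which for \<open>x > ln K\<close> is also the height seen at \<open>x - ln K\<close> by
  the scaling with index \<open>n\<close>. As the tail is monotone and the limit strictly monotone, the two
  arguments must agree asymptotically (the convergence of types argument). Both scalings being
  affine, agreement at two points is agreement everywhere: \<open>a\<^sub>m / a\<^sub>n\<close> tends to \<open>1\<close> and
  \<open>(b\<^sub>m - b\<^sub>n) / a\<^sub>n\<close> to \<open>- ln K\<close> (lemma \<open>scaling_ratio_limits\<close>). An arbitrary \<open>y\<close> is thus seen by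
  the scaling with index \<open>m\<close> near the point \<open>y + ln K\<close>, and this is positive if \<open>K\<close> is large enough
  (lemma \<open>exponential_tail_extends\<close>).
\<close>

section \<open>Powers and scaled tails\<close>

text \<open>
  For \<open>0 < p\<close>, both directions rest on \<open>1 - p \<le> - ln p \<le> (1 - p) / p\<close>: once \<open>p n\<close> tends to \<open>1\<close>, the
  quantities \<open>n (1 - p n)\<close> and \<open>- n ln (p n)\<close> have the same limit.
\<close>

lemma power_tendsto_exp_iff:
  fixes p :: "nat \<Rightarrow> real"
  assumes p0: "\<And>n. 0 \<le> p n" and p1: "\<And>n. p n \<le> 1"
  shows "(\<lambda>n. p n ^ n) \<longlonglongrightarrow> exp (- c) \<longleftrightarrow> (\<lambda>n. real n * (1 - p n)) \<longlonglongrightarrow> c"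
proof
  assume lim: "(\<lambda>n. p n ^ n) \<longlonglongrightarrow> exp (- c)"
  have "eventually (\<lambda>n. 0 < p n ^ n) sequentially"
    using order_tendstoD(1)[OF lim, of 0] by simp
  then have pos: "eventually (\<lambda>n. 0 < p n) sequentially"
    using eventually_gt_at_top[of 0]
    by eventually_elim (metis p0 less_eq_real_def power_eq_0_iff)
  have "(\<lambda>n. ln (p n ^ n)) \<longlonglongrightarrow> - c"
    using tendsto_ln[OF lim] by simp
  then have nln: "(\<lambda>n. real n * ln (p n)) \<longlonglongrightarrow> - c"
    by (rule Lim_transform_eventually) (use pos in eventually_elim, simp add: ln_realpow)
  have "(\<lambda>n. real n * ln (p n) * inverse (real n)) \<longlonglongrightarrow> - c * 0"
    by (intro tendsto_mult nln lim_inverse_n)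
  then have "(\<lambda>n. ln (p n)) \<longlonglongrightarrow> 0"
    unfolding mult_zero_right
    by (rule Lim_transform_eventually)
      (use eventually_gt_at_top[of 0] in eventually_elim, simp)
  then have "(\<lambda>n. exp (ln (p n))) \<longlonglongrightarrow> 1"
    using tendsto_exp[where a = 0] by simp
  then have plim: "p \<longlonglongrightarrow> 1"
    by (rule Lim_transform_eventually)
      (use pos in eventually_elim, simp)
  have lower: "(\<lambda>n. - p n * (real n * ln (p n))) \<longlonglongrightarrow> c"
    using tendsto_mult[OF tendsto_minus[OF plim] nln] by simp
  have upper: "(\<lambda>n. - (real n * ln (p n))) \<longlonglongrightarrow> c"
    using tendsto_minus[OF nln] by simp
  show "(\<lambda>n. real n * (1 - p n)) \<longlonglongrightarrow> c"
  proof (rule tendsto_sandwich[OF _ _ lower upper])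
    show "eventually (\<lambda>n. - p n * (real n * ln (p n)) \<le> real n * (1 - p n)) sequentially"
      using pos
    proof eventually_elim
      case (elim n)
      have "- ln (p n) \<le> inverse (p n) - 1"
        using ln_le_minus_one[of "inverse (p n)"] elim by (simp add: ln_inverse)
      then have "p n * - ln (p n) \<le> p n * (inverse (p n) - 1)"
        using elim by (intro mult_left_mono) auto
      then have "real n * (- p n * ln (p n)) \<le> real n * (1 - p n)"
        using elim by (intro mult_left_mono) (auto simp: algebra_simps)
      then show ?case by (simp add: mult_ac)
    qed
    show "eventually (\<lambda>n. real n * (1 - p n) \<le> - (real n * ln (p n))) sequentially"
      using pos
    proof eventually_elim
      case (elim n)
      have "real n * (1 - p n) \<le> real n * (- ln (p n))"
        using ln_le_minus_one[OF elim] by (intro mult_left_mono) auto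
      then show ?case by simp
    qed
  qed
next
  assume lim: "(\<lambda>n. real n * (1 - p n)) \<longlonglongrightarrow> c"
  have "(\<lambda>n. real n * (1 - p n) * inverse (real n)) \<longlonglongrightarrow> c * 0"
    by (intro tendsto_mult lim lim_inverse_n)
  then have "(\<lambda>n. 1 - p n) \<longlonglongrightarrow> 0"
    unfolding mult_zero_right
    by (rule Lim_transform_eventually)
      (use eventually_gt_at_top[of 0] in eventually_elim, simp)
  then have plim: "p \<longlonglongrightarrow> 1"
    using tendsto_diff[OF tendsto_const[of 1]] by fastforce
  have pos: "eventually (\<lambda>n. 0 < p n) sequentially"
    using order_tendstoD(1)[OF plim, of 0] by simp
  have lower: "(\<lambda>n. - (real n * (1 - p n)) / p n) \<longlonglongrightarrow> - c"
    using tendsto_divide[OF tendsto_minus[OF lim] plim] by simp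
  have upper: "(\<lambda>n. - (real n * (1 - p n))) \<longlonglongrightarrow> - c"
    by (rule tendsto_minus[OF lim])
  have "(\<lambda>n. real n * ln (p n)) \<longlonglongrightarrow> - c"
  proof (rule tendsto_sandwich[OF _ _ lower upper])
    show "eventually (\<lambda>n. - (real n * (1 - p n)) / p n \<le> real n * ln (p n)) sequentially"
      using pos
    proof eventually_elim
      case (elim n)
      have "1 - inverse (p n) \<le> ln (p n)"
        using ln_le_minus_one[of "inverse (p n)"] elim by (simp add: ln_inverse)
      then have "real n * (1 - inverse (p n)) \<le> real n * ln (p n)"
        by (intro mult_left_mono) auto
      then show ?case using elim by (simp add: field_simps)
    qed
    show "eventually (\<lambda>n. real n * ln (p n) \<le> - (real n * (1 - p n))) sequentially"
      using pos
    proof eventually_elim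
      case (elim n)
      have "real n * ln (p n) \<le> real n * (p n - 1)"
        using ln_le_minus_one[OF elim] by (intro mult_left_mono) auto
      then show ?case by (simp add: algebra_simps)
    qed
  qed
  then have "(\<lambda>n. exp (real n * ln (p n))) \<longlonglongrightarrow> exp (- c)"
    by (rule tendsto_exp)
  then show "(\<lambda>n. p n ^ n) \<longlonglongrightarrow> exp (- c)"
    by (rule Lim_transform_eventually)
      (use pos in eventually_elim, simp add: exp_of_nat_mult)
qed

section \<open>Antitone functions converging on a half line\<close>

text \<open>
  Antitone functions converging pointwise to a continuous limit converge along moving arguments
  too, since a moving argument is eventually squeezed between two fixed ones.
\<close>

lemma antitone_family_tendsto_moving:
  fixes g :: "'i \<Rightarrow> real \<Rightarrow> real" and h :: "real \<Rightarrow> real"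
  assumes anti: "eventually (\<lambda>i. antimono (g i)) L"
    and lim: "\<And>x. c < x \<Longrightarrow> ((\<lambda>i. g i x) \<longlongrightarrow> h x) L"
    and cont: "isCont h x" and x: "c < x"
    and z: "(z \<longlongrightarrow> x) L"
  shows "((\<lambda>i. g i (z i)) \<longlongrightarrow> h x) L"
proof (rule order_tendstoI)
  fix e assume e: "e < h x"
  have "eventually (\<lambda>y. e < h y) (at_right x)"
    using order_tendstoD(1)[OF isContD[OF cont] e] by (simp add: eventually_at_split)
  then obtain u where u: "x < u" "\<And>y. x < y \<Longrightarrow> y < u \<Longrightarrow> e < h y"
    by (auto simp: eventually_at_right_field)
  obtain y where y: "x < y" "y < u" using dense[OF u(1)] by blast
  then have "e < h y" "c < y" using u(2) x by auto
  from anti order_tendstoD(1)[OF lim[OF \<open>c < y\<close>] \<open>e < h y\<close>] order_tendstoD(2)[OF z \<open>x < y\<close>]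
  show "eventually (\<lambda>i. e < g i (z i)) L"
    by eventually_elim (rule order.strict_trans2, assumption, erule antimonoD, rule less_imp_le)
next
  fix e assume e: "h x < e"
  have "eventually (\<lambda>y. h y < e) (at_left x)"
    using order_tendstoD(2)[OF isContD[OF cont] e] by (simp add: eventually_at_split)
  then obtain u where u: "u < x" "\<And>y. u < y \<Longrightarrow> y < x \<Longrightarrow> h y < e"
    by (auto simp: eventually_at_left_field)
  have "max u c < x" using u x by simp
  then obtain y where y: "max u c < y" "y < x" using dense by blast
  then have "h y < e" "c < y" using u(2) by auto
  from anti order_tendstoD(2)[OF lim[OF \<open>c < y\<close>] \<open>h y < e\<close>] order_tendstoD(1)[OF z \<open>y < x\<close>]
  show "eventually (\<lambda>i. g i (z i) < e) L"
    by eventually_elim (rule order.strict_trans1[rotated], assumption, erule antimonoD, rule less_imp_le)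
qed

text \<open>
  Conversely, strict monotonicity of the limit lets the arguments be read off from the values:
  an argument staying away from \<open>x\<close> would keep the value away from \<open>h x\<close>.
\<close>

lemma antitone_family_argument_tendsto:
  fixes g :: "'i \<Rightarrow> real \<Rightarrow> real" and h :: "real \<Rightarrow> real"
  assumes anti: "eventually (\<lambda>i. antimono (g i)) L"
    and lim: "\<And>x. c < x \<Longrightarrow> ((\<lambda>i. g i x) \<longlongrightarrow> h x) L"
    and strict: "\<And>x y. x < y \<Longrightarrow> h y < h x" and x: "c < x"
    and vals: "((\<lambda>i. g i (z i)) \<longlongrightarrow> h x) L"
  shows "(z \<longlongrightarrow> x) L"
proof (rule order_tendstoI)
  fix e assume "e < x"
  then obtain y where y: "max e c < y" "y < x" using x dense[of "max e c" x] by auto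
  obtain v where v: "h x < v" "v < h y" using dense[OF strict[OF y(2)]] by blast
  have "c < y" using y by simp
  from anti order_tendstoD(1)[OF lim[OF \<open>c < y\<close>] v(2)] order_tendstoD(2)[OF vals v(1)]
  show "eventually (\<lambda>i. e < z i) L"
  proof eventually_elim
    case (elim i)
    have "y < z i"
    proof (rule ccontr)
      assume "\<not> y < z i"
      then have "g i y \<le> g i (z i)" using elim(1) by (simp add: antimono_def)
      then show False using elim(2,3) by simp
    qed
    then show ?case using y by simp
  qed
next
  fix e assume e: "x < e"
  obtain v where v: "h e < v" "v < h x" using dense[OF strict[OF e]] by blast
  have "c < e" using x e by simp
  from anti order_tendstoD(2)[OF lim[OF \<open>c < e\<close>] v(1)] order_tendstoD(1)[OF vals v(2)]
  show "eventually (\<lambda>i. z i < e) L"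
  proof eventually_elim
    case (elim i)
    show ?case
    proof (rule ccontr)
      assume "\<not> z i < e"
      then have "g i (z i) \<le> g i e" using elim(1) by (simp add: antimono_def)
      then show False using elim(2,3) by simp
    qed
  qed
qed

section \<open>Exponential tails extend to the whole line\<close>

lemma filterlim_div_const_at_top:
  fixes K :: nat
  assumes "0 < K"
  shows "filterlim (\<lambda>n. n div K) sequentially sequentially"
  unfolding filterlim_at_top
proof
  fix N
  show "eventually (\<lambda>n. N \<le> n div K) sequentially"
    using eventually_ge_at_top[of "N * K"]
    by eventually_elim (simp add: assms less_eq_div_iff_mult_less_eq)
qed

lemma eventually_div_const_pos:
  fixes K :: nat
  assumes "0 < K"
  shows "eventually (\<lambda>n. 0 < n div K) sequentially"
  using eventually_ge_at_top[of K] by eventually_elim (simp add: assms div_greater_zero_iff)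

lemma quotient_div_const_tendsto:
  fixes K :: nat
  assumes K: "0 < K"
  shows "(\<lambda>n. real n / real (n div K)) \<longlonglongrightarrow> real K"
proof -
  let ?m = "\<lambda>n. n div K"
  have m: "filterlim ?m sequentially sequentially"
    by (rule filterlim_div_const_at_top[OF K])
  have "(\<lambda>n. real K + real K * inverse (real (?m n))) \<longlonglongrightarrow> real K + real K * 0"
    by (intro tendsto_intros filterlim_compose[OF lim_inverse_n m])
  then have upper: "(\<lambda>n. real K + real K * inverse (real (?m n))) \<longlonglongrightarrow> real K"
    by simp
  have pos: "eventually (\<lambda>n. 0 < ?m n) sequentially"
    by (rule eventually_div_const_pos[OF K])
  show ?thesis
  proof (rule tendsto_sandwich[OF _ _ tendsto_const upper])
    show "eventually (\<lambda>n. real K \<le> real n / real (?m n)) sequentially"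
      using pos
    proof eventually_elim
      case (elim n)
      have "real (K * ?m n) \<le> real n"
        by (simp only: of_nat_le_iff) simp
      then show ?case using elim by (simp add: pos_le_divide_eq)
    qed
    show "eventually (\<lambda>n. real n / real (?m n) \<le> real K + real K * inverse (real (?m n)))
      sequentially"
      using pos
    proof eventually_elim
      case (elim n)
      have "n \<le> K * ?m n + K"
        using mult_div_mod_eq[of K n] mod_less_divisor[OF K, of n] by linarith
      then have "real n \<le> real (K * ?m n + K)"
        by (simp only: of_nat_le_iff)
      then show ?case using elim by (simp add: field_simps)
    qed
  qed
qed

lemma antimono_scaled_tail:
  fixes U :: "real \<Rightarrow> real"
  assumes "antimono U" "0 < s"
  shows "antimono (\<lambda>x. real n * U (s * x + t))"
  using assms by (auto simp: antimono_def intro!: mult_left_mono)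

text \<open>
  For \<open>x > ln K\<close>, the number \<open>a\<^sub>m x + b\<^sub>m\<close> with \<open>m = n div K\<close>, written in the coordinate of
  index \<open>n\<close>, is found from the tail at that point, which is \<open>n / m\<close> times its value in the scaling
  of index \<open>m\<close>. Two such \<open>x\<close> determine the affine change of coordinate.
\<close>

lemma scaling_ratio_limits:
  fixes U :: "real \<Rightarrow> real" and a b :: "nat \<Rightarrow> real" and K :: nat
  assumes U: "antimono U" and a: "\<And>n. 1 \<le> n \<Longrightarrow> 0 < a n"
    and lim: "\<And>x. 0 < x \<Longrightarrow> (\<lambda>n. real n * U (a n * x + b n)) \<longlonglongrightarrow> exp (- x)"
    and K: "0 < K"
  shows "(\<lambda>n. a (n div K) / a n) \<longlonglongrightarrow> 1"
    and "(\<lambda>n. (b (n div K) - b n) / a n) \<longlonglongrightarrow> - ln (real K)"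
proof -
  let ?m = "\<lambda>n. n div K"
  let ?z = "\<lambda>x n. (a (?m n) * x + b (?m n) - b n) / a n"
  have m: "filterlim ?m sequentially sequentially"
    by (rule filterlim_div_const_at_top[OF K])
  have mpos: "eventually (\<lambda>n. 0 < ?m n) sequentially"
    by (rule eventually_div_const_pos[OF K])
  have anti: "eventually (\<lambda>n. antimono (\<lambda>x. real n * U (a n * x + b n))) sequentially"
    using eventually_ge_at_top[of 1]
    by eventually_elim (intro antimono_scaled_tail U a)
  have lnK: "0 \<le> ln (real K)" using K by simp
  have z: "?z x \<longlonglongrightarrow> x - ln (real K)" if x: "ln (real K) < x" for x
  proof (rule antitone_family_argument_tendsto[OF anti, where c = 0 and h = "\<lambda>x. exp (- x)"])
    have x0: "0 < x" using x lnK by simp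
    have "(\<lambda>n. real n / real (?m n) * (real (?m n) * U (a (?m n) * x + b (?m n))))
        \<longlonglongrightarrow> real K * exp (- x)"
      by (intro tendsto_mult quotient_div_const_tendsto K
          filterlim_compose[OF lim[OF x0] m])
    moreover have "real K * exp (- x) = exp (- (x - ln (real K)))"
      using K by (simp add: exp_diff exp_minus field_simps)
    ultimately have "(\<lambda>n. real n / real (?m n) * (real (?m n) * U (a (?m n) * x + b (?m n))))
        \<longlonglongrightarrow> exp (- (x - ln (real K)))"
      by simp
    then show "(\<lambda>n. real n * U (a n * ?z x n + b n)) \<longlonglongrightarrow> exp (- (x - ln (real K)))"
    proof (rule Lim_transform_eventually)
      show "eventually (\<lambda>n. real n / real (?m n) * (real (?m n) * U (a (?m n) * x + b (?m n)))
          = real n * U (a n * ?z x n + b n)) sequentially"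
        using mpos eventually_ge_at_top[of 1]
      proof eventually_elim
        case (elim n)
        then have "a n * ?z x n + b n = a (?m n) * x + b (?m n)"
          using a[of n] by simp
        then show ?case using elim by simp
      qed
    qed
  qed (use x lim in auto)
  \<comment> \<open>\<open>?z x n\<close> is affine in \<open>x\<close>: two points above \<open>ln K\<close> give the slope, one of them the intercept.\<close>
  let ?l = "ln (real K)"
  have z1: "?z (?l + 1) \<longlonglongrightarrow> 1" and z2: "?z (?l + 2) \<longlonglongrightarrow> 2"
    using z[of "?l + 1"] z[of "?l + 2"] by simp_all
  have "(\<lambda>n. ?z (?l + 2) n - ?z (?l + 1) n) \<longlonglongrightarrow> 2 - 1"
    by (intro tendsto_diff z1 z2)
  moreover have "?z (?l + 2) n - ?z (?l + 1) n = a (?m n) / a n" for n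
    by (simp add: diff_divide_distrib[symmetric] algebra_simps)
  ultimately show ratio: "(\<lambda>n. a (?m n) / a n) \<longlonglongrightarrow> 1"
    by simp
  have "(\<lambda>n. ?z (?l + 1) n - (?l + 1) * (a (?m n) / a n)) \<longlonglongrightarrow> 1 - (?l + 1) * 1"
    by (intro tendsto_intros z1 ratio)
  moreover have "?z (?l + 1) n - (?l + 1) * (a (?m n) / a n) = (b (?m n) - b n) / a n" for n
    by (simp add: add_divide_distrib diff_divide_distrib mult.commute)
  ultimately show "(\<lambda>n. (b (?m n) - b n) / a n) \<longlonglongrightarrow> - ?l"
    by simp
qed

text \<open>
  The index change of \<open>scaling_ratio_limits\<close> moves \<open>y\<close> to a point close to \<open>y + ln K\<close>, where the
  limit is known as soon as \<open>K > exp (- y)\<close>.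
\<close>

lemma exponential_tail_extends:
  fixes U :: "real \<Rightarrow> real" and a b :: "nat \<Rightarrow> real"
  assumes U: "antimono U" and a: "\<And>n. 1 \<le> n \<Longrightarrow> 0 < a n"
    and lim: "\<And>x. 0 < x \<Longrightarrow> (\<lambda>n. real n * U (a n * x + b n)) \<longlonglongrightarrow> exp (- x)"
  shows "(\<lambda>n. real n * U (a n * y + b n)) \<longlonglongrightarrow> exp (- y)"
proof -
  obtain K :: nat where Ky: "exp (- y) < real K"
    using reals_Archimedean2 by blast
  then have K: "0 < K"
    using exp_gt_zero[of "- y"] by (metis less_trans of_nat_0_less_iff)
  have "- y < ln (real K)"
    using Ky K ln_less_cancel_iff[of "exp (- y)" "real K"] by simp
  then have yK: "0 < y + ln (real K)" by simp
  let ?m = "\<lambda>n. n div K"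
  \<comment> \<open>The coordinate in the scaling of index \<open>n div K\<close> of the point \<open>a n * y + b n\<close>.\<close>
  let ?w = "\<lambda>n. (y - (b (?m n) - b n) / a n) / (a (?m n) / a n)"
  have m: "filterlim ?m sequentially sequentially"
    by (rule filterlim_div_const_at_top[OF K])
  have mpos: "eventually (\<lambda>n. 0 < ?m n) sequentially"
    by (rule eventually_div_const_pos[OF K])
  have "?w \<longlonglongrightarrow> (y - - ln (real K)) / 1"
    by (intro tendsto_divide tendsto_diff tendsto_const
        scaling_ratio_limits[OF U a lim K]) simp_all
  then have w: "?w \<longlonglongrightarrow> y + ln (real K)" by simp
  have anti: "eventually (\<lambda>n. antimono (\<lambda>x. real (?m n) * U (a (?m n) * x + b (?m n)))) sequentially"
    using mpos by eventually_elim (intro antimono_scaled_tail U a, simp)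
  have "(\<lambda>n. real (?m n) * U (a (?m n) * ?w n + b (?m n))) \<longlonglongrightarrow> exp (- (y + ln (real K)))"
    by (rule antitone_family_tendsto_moving[OF anti, where c = 0 and h = "\<lambda>x. exp (- x)",
          OF filterlim_compose[OF lim m] _ yK w])
      (auto intro!: continuous_intros)
  then have "(\<lambda>n. real n / real (?m n) * (real (?m n) * U (a (?m n) * ?w n + b (?m n))))
      \<longlonglongrightarrow> real K * exp (- (y + ln (real K)))"
    by (intro tendsto_mult quotient_div_const_tendsto K)
  moreover have "real K * exp (- (y + ln (real K))) = exp (- y)"
    using K by (simp add: exp_diff exp_minus)
  ultimately have "(\<lambda>n. real n / real (?m n) * (real (?m n) * U (a (?m n) * ?w n + b (?m n))))
      \<longlonglongrightarrow> exp (- y)"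
    by simp
  then show ?thesis
  proof (rule Lim_transform_eventually)
    show "eventually (\<lambda>n. real n / real (?m n) * (real (?m n) * U (a (?m n) * ?w n + b (?m n)))
        = real n * U (a n * y + b n)) sequentially"
      using mpos eventually_ge_at_top[of 1]
    proof eventually_elim
      case (elim n)
      have "0 < a n" "0 < a (?m n)" using elim by (auto intro!: a)
      then have "a (?m n) * ?w n + b (?m n) = a n * y + b n"
        by (simp add: field_simps)
      then show ?case using elim by simp
    qed
  qed
qed

section \<open>Free and classical limits\<close>

lemma distribution_function_mono:
  assumes "distribution_function F"
  shows "mono F"
proof -
  obtain M where M: "real_distribution M" "F = cdf M"
    using assms by (auto simp: distribution_function_def)
  interpret real_distribution M by fact
  show ?thesis by (auto simp: M mono_def intro: cdf_nondecreasing)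
qed

lemma classical_gumbel_limit_iff_exponential_tail:
  assumes "distribution_function F"
  shows "(\<lambda>n. F (a n * x + b n) ^ n) \<longlonglongrightarrow> gumbel_df x \<longleftrightarrow>
    (\<lambda>n. real n * (1 - F (a n * x + b n))) \<longlonglongrightarrow> exp (- x)"
  unfolding gumbel_df_def
  by (rule power_tendsto_exp_iff) (rule distribution_function_bounds[OF assms])+

text \<open>
  For \<open>x > 0\<close> the limit \<open>1 - exp (- x)\<close> is positive, so the truncation at \<open>0\<close> is eventually
  inactive and the scaled tail can be recovered from the free iterate.
\<close>

lemma free_exponential_limit_imp_tail_pos:
  assumes F: "distribution_function F" and x: "0 < x"
    and lim: "(\<lambda>n. free_max_power F n (a n * x + b n)) \<longlonglongrightarrow> exponential_df x"
  shows "(\<lambda>n. real n * (1 - F (a n * x + b n))) \<longlonglongrightarrow> exp (- x)"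
proof -
  have G: "exponential_df x = 1 - exp (- x)" "0 < exponential_df x"
    using x by (auto simp: exponential_df_def)
  have "(\<lambda>n. 1 - free_max_power F n (a n * x + b n)) \<longlonglongrightarrow> 1 - exponential_df x"
    by (intro tendsto_intros lim)
  then have "(\<lambda>n. 1 - free_max_power F n (a n * x + b n)) \<longlonglongrightarrow> exp (- x)"
    by (simp add: G)
  then show ?thesis
  proof (rule Lim_transform_eventually)
    show "eventually (\<lambda>n. 1 - free_max_power F n (a n * x + b n) =
        real n * (1 - F (a n * x + b n))) sequentially"
      using order_tendstoD(1)[OF lim G(2)]
      by eventually_elim (auto simp: free_max_power_eq[OF F] max_def algebra_simps split: if_splits)
  qed
qed

lemma tail_imp_free_exponential_limit:
  assumes F: "distribution_function F"
    and lim: "(\<lambda>n. real n * (1 - F (a n * x + b n))) \<longlonglongrightarrow> exp (- x)"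
  shows "(\<lambda>n. free_max_power F n (a n * x + b n)) \<longlonglongrightarrow> exponential_df x"
proof -
  have "(\<lambda>n. max (1 - real n * (1 - F (a n * x + b n))) 0) \<longlonglongrightarrow> max (1 - exp (- x)) 0"
    by (intro tendsto_intros lim)
  then show ?thesis
    by (simp add: free_max_power_eq[OF F] exponential_df_def algebra_simps)
qed

lemma free_exponential_limit_iff_classical_gumbel_limit:
  fixes a b :: "nat \<Rightarrow> real"
  assumes F: "distribution_function F" and a: "\<forall>n\<ge>1. 0 < a n"
  shows "(\<forall>x. (\<lambda>n. free_max_power F n (a n * x + b n)) \<longlonglongrightarrow> exponential_df x) \<longleftrightarrow>
    (\<forall>x. (\<lambda>n. F (a n * x + b n) ^ n) \<longlonglongrightarrow> gumbel_df x)"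
proof
  assume free: "\<forall>x. (\<lambda>n. free_max_power F n (a n * x + b n)) \<longlonglongrightarrow> exponential_df x"
  have "antimono (\<lambda>t. 1 - F t)"
    using distribution_function_mono[OF F] by (simp add: antimono_def mono_def)
  then have "(\<lambda>n. real n * (1 - F (a n * x + b n))) \<longlonglongrightarrow> exp (- x)" for x
    by (rule exponential_tail_extends)
      (use a free in \<open>auto intro: free_exponential_limit_imp_tail_pos[OF F]\<close>)
  then show "\<forall>x. (\<lambda>n. F (a n * x + b n) ^ n) \<longlonglongrightarrow> gumbel_df x"
    by (simp add: classical_gumbel_limit_iff_exponential_tail[OF F])
next
  assume "\<forall>x. (\<lambda>n. F (a n * x + b n) ^ n) \<longlonglongrightarrow> gumbel_df x"
  then show "\<forall>x. (\<lambda>n. free_max_power F n (a n * x + b n)) \<longlonglongrightarrow> exponential_df x"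
    by (simp add: classical_gumbel_limit_iff_exponential_tail[OF F]
        tail_imp_free_exponential_limit[OF F])
qed

text \<open>
  Both limit distribution functions are continuous, so convergence at continuity points is
  convergence everywhere and the two domains of attraction agree because the same normalizing
  constants serve for both.
\<close>

theorem theorem6p11:
  fixes F :: "real \<Rightarrow> real"
  assumes "distribution_function F"
  shows "(F \<in> free_max_domain_of_attraction exponential_df \<longleftrightarrow>
          F \<in> classical_max_domain_of_attraction gumbel_df) \<and>
         (\<forall>a b :: nat \<Rightarrow> real. (\<forall>n\<ge>1. 0 < a n) \<longrightarrow>
           ((\<forall>x. (\<lambda>n. free_max_power F n (a n * x + b n)) \<longlonglongrightarrow> exponential_df x) \<longleftrightarrow>
            (\<forall>x. (\<lambda>n. F (a n * x + b n) ^ n) \<longlonglongrightarrow> gumbel_df x)))"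
proof -
  have cont: "isCont exponential_df x" "isCont gumbel_df x" for x
    unfolding exponential_df_def[abs_def] gumbel_df_def[abs_def]
    by (intro continuous_intros)+
  show ?thesis
    using free_exponential_limit_iff_classical_gumbel_limit[OF assms]
    unfolding free_max_domain_of_attraction_def classical_max_domain_of_attraction_def
    by (simp add: cont assms) blast
qed

end
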